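(* Let $\epsilon\in(0,1)$ and let $T$ and the iterates $(\theta_t,\lambda_t)$ of the robust primal-dual algorithm be as described in the context, so that $\min_{1\le t\le T}\|G_t\|\le2\epsilon$. Let $W\in\arg\min_{1\le t\le T}\|G_t\|$. If $$\lambda_W-\frac1{\beta_W}\nabla_\lambda V^L(\theta_W,\lambda_W)\in[0,\Lambda^* ),$$ then $\pi_{\theta_W}$ satisfies the robust constraint with a $2\epsilon$-violation, that is, $V_c^{\pi_{\theta_W}}(\rho)\ge b-2\epsilon$.
   Context: $\mathcal S,\mathcal A$ are finite, $\gamma\in[0,1)$, $r,c:\mathcal S\times\mathcal A\to[0,1]$, $b>0$, $\rho\in\Delta_{\mathcal S}$ (probability simplex), and $\mathcal P=\bigotimes_{s,a}\mathcal P_s^a$, $\mathcal P_s^a\subseteq\Delta_{\mathcal S}$, is an $(s,a)$-rectangular uncertainty set of transition kernels. $\Pi_\Theta=\{\pi_\theta:\theta\in\Theta\}$ is a class of stationary policies, $\Theta\subseteq\mathbb R^d$ nonempty closed convex, with $\|\nabla_\theta\pi_\theta(a|s)\|\le k$, $\|\nabla_\theta^2\pi_\theta(a|s)\|\le l$ for all $s,a,\theta$. For $h\in\{r,c\}$, $V_h^\pi(s)=\min_{\kappa\in\bigotimes_{t\ge0}\mathcal P}\mathbb E_\kappa[\sum_{t\ge0}\gamma^t h(S_t,A_t)\mid S_0=s,\pi]$ is the robust value function ($\kappa=(\mathsf P_0,\mathsf P_1,\dots)$, $\mathsf P_t\in\mathcal P$) and $V_h^\pi(\rho)=\sum_s\rho(s)V_h^\pi(s)$.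 The robust constraint is $V_c^{\pi}(\rho)\ge b$. Slater condition: there exist $\zeta>0$ and $\pi\in\Pi_\Theta$ with $V_c^\pi(\rho)-b\ge\zeta$. $\Lambda^*$ is a fixed constant with $\Lambda^*\ge\frac2{\zeta(1-\gamma)}$. Lagrangian: $V^L(\theta,\lambda)=V_r^{\pi_\theta}(\rho)+\lambda(V_c^{\pi_\theta}(\rho)-b)$, assumed differentiable with gradients that are Lipschitz: $\nabla_\lambda V^L$ is $L_{11}$-Lipschitz in $\theta$ and $L_{12}$-Lipschitz in $\lambda$, $\nabla_\theta V^L$ is $L_{21}$-Lipschitz in $\theta$ and $L_{22}$-Lipschitz in $\lambda$, on $\Theta\times[0,\Lambda^*]$. $\prod_X$ is Euclidean projection onto $X$. Robust primal-dual algorithm: for $t=1,2,\dots$, $$\lambda_{t+1}=\prod_{[0,\Lambda^*]}\left(\lambda_t-\tfrac1{\beta_t}\left(V_c^{\pi_{\theta_t}}(\rho)-b\right)-\tfrac{b_t}{\beta_t}\lambda_t\right),\quad \theta_{t+1}=\prod_\Theta\left(\theta_t+\tfrac1{\alpha_t}\left(\nabla_\theta V_r^{\pi_{\theta_t}}(\rho)+\lambda_{t+1}\nabla_\theta V_c^{\pi_{\theta_t}}(\rho)\right)\right),$$ with $C\ge\max\{L_{11},L_{22}\}$, $C>0$, $\nu>0$, $\tau>2$, $\xi>\frac{2\nu+L_{21}}{C^2}$, $b_t=\frac{19}{20\xi t^{0.25}}$, $\beta_t=\frac1\xi$, $\mu_t=\xi C^2+\frac{16\tau C^2}{\xi b_{t+1}^2}-2\nu$,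 $\alpha_t=\nu+\mu_t$. The number of iterations $T=\mathcal O(\epsilon^{-4})$ is chosen so that $\min_{1\le t\le T}\|G_t\|\le2\epsilon$, where $$G_t=\begin{bmatrix}\beta_t\left(\lambda_t-\prod_{[0,\Lambda^*]}\left(\lambda_t-\frac1{\beta_t}\nabla_\lambda V^L(\theta_t,\lambda_t)\right)\right)\\ \alpha_t\left(\theta_t-\prod_\Theta\left(\theta_t+\frac1{\alpha_t}\nabla_\theta V^L(\theta_t,\lambda_t)\right)\right)\end{bmatrix}.$$ *)

theory Defs
  imports "HOL-Probability.Probability" "HOL-Library.Landau_Symbols"
begin

section \<open>Robust value functions\<close>

type_synonym ('s, 'a) kernel = "'s \<Rightarrow> 'a \<Rightarrow> 's pmf"
type_synonym ('s, 'a) policy = "'s \<Rightarrow> 'a pmf"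

definition rectangular :: "('s \<Rightarrow> 'a \<Rightarrow> 's pmf set) \<Rightarrow> ('s, 'a) kernel set" where
  "rectangular U = {p. \<forall>s a. p s a \<in> U s a}"

text \<open>
  Conditional law of the state-action pair at time \<open>t\<close>, given the trajectory \<open>\<omega>\<close> up to time
  \<open>t - 1\<close>, when the chain starts in \<open>s\<close>. The kernel \<open>\<kappa> t\<close> governs the transition from time \<open>t\<close>
  to time \<open>Suc t\<close>.
\<close>

primrec step_law ::
  "(nat \<Rightarrow> ('s, 'a) kernel) \<Rightarrow> ('s, 'a) policy \<Rightarrow> 's \<Rightarrow> nat \<Rightarrow> (nat \<Rightarrow> 's \<times> 'a) \<Rightarrow> ('s \<times> 'a) pmf"
where
  "step_law \<kappa> \<pi> s 0 \<omega> = map_pmf (Pair s) (\<pi> s)"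
| "step_law \<kappa> \<pi> s (Suc t) \<omega> =
     bind_pmf (\<kappa> t (fst (\<omega> t)) (snd (\<omega> t))) (\<lambda>s'. map_pmf (Pair s') (\<pi> s'))"

lemma Ionescu_Tulcea_step_law:
  fixes \<kappa> :: "nat \<Rightarrow> ('s::finite, 'a::finite) kernel"
  shows "Ionescu_Tulcea (\<lambda>t \<omega>. measure_pmf (step_law \<kappa> \<pi> s t \<omega>)) (\<lambda>_. count_space UNIV)"
proof
  fix t
  show "(\<lambda>\<omega>. measure_pmf (step_law \<kappa> \<pi> s t \<omega>))
      \<in> measurable (PiM {0..<t} (\<lambda>_. count_space UNIV)) (subprob_algebra (count_space UNIV))"
  proof (cases t)
    case 0
    then show ?thesis
      by (simp add: measurable_const measure_pmf_in_subprob_algebra)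
  next
    case (Suc n)
    have "(\<lambda>x. measure_pmf (bind_pmf (\<kappa> n (fst x) (snd x)) (\<lambda>s'. map_pmf (Pair s') (\<pi> s'))))
        \<in> measurable (count_space UNIV) (subprob_algebra (count_space UNIV))"
      by (simp add: measure_pmf_in_subprob_algebra)
    moreover have "(\<lambda>\<omega>. \<omega> n) \<in> measurable (PiM {0..<t} (\<lambda>_. count_space UNIV)) (count_space UNIV)"
      using Suc by (intro measurable_component_singleton) auto
    ultimately show ?thesis
      unfolding Suc step_law.simps using measurable_compose by blast
  qed
qed

text \<open>The Ionescu-Tulcea measure on infinite state-action trajectories.\<close>

definition trajectories ::
  "(nat \<Rightarrow> ('s, 'a) kernel) \<Rightarrow> ('s, 'a) policy \<Rightarrow> 's \<Rightarrow> (nat \<Rightarrow> 's \<times> 'a) measure"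
where
  "trajectories \<kappa> \<pi> s =
     projective_family.lim UNIV
       (Ionescu_Tulcea.CI (\<lambda>t \<omega>. measure_pmf (step_law \<kappa> \<pi> s t \<omega>)) (\<lambda>_. count_space UNIV))
       (\<lambda>_. count_space UNIV)"

definition discounted_return ::
  "real \<Rightarrow> ('s \<Rightarrow> 'a \<Rightarrow> real) \<Rightarrow> (nat \<Rightarrow> ('s, 'a) kernel) \<Rightarrow> ('s, 'a) policy \<Rightarrow> 's \<Rightarrow> real"
where
  "discounted_return \<gamma> h \<kappa> \<pi> s =
     (\<integral>\<omega>. (\<Sum>t. \<gamma> ^ t * h (fst (\<omega> t)) (snd (\<omega> t))) \<partial>trajectories \<kappa> \<pi> s)"

text \<open>
  The infimum is the minimum whenever the latter is attained; it is well defined without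
  closedness of the uncertainty sets.
\<close>

definition robust_value ::
  "('s \<Rightarrow> 'a \<Rightarrow> 's pmf set) \<Rightarrow> real \<Rightarrow> ('s \<Rightarrow> 'a \<Rightarrow> real) \<Rightarrow> ('s, 'a) policy \<Rightarrow> 's \<Rightarrow> real"
where
  "robust_value U \<gamma> h \<pi> s =
     (INF \<kappa>\<in>{\<kappa>. \<forall>t. \<kappa> t \<in> rectangular U}. discounted_return \<gamma> h \<kappa> \<pi> s)"

definition robust_value_from ::
  "'s::finite pmf \<Rightarrow> ('s \<Rightarrow> 'a \<Rightarrow> 's pmf set) \<Rightarrow> real \<Rightarrow> ('s \<Rightarrow> 'a \<Rightarrow> real) \<Rightarrow> ('s, 'a) policy \<Rightarrow> real"
where
  "robust_value_from \<rho> U \<gamma> h \<pi> = (\<Sum>s\<in>UNIV. pmf \<rho> s * robust_value U \<gamma> h \<pi> s)"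

section \<open>Gradients and smooth policy classes\<close>

text \<open>
  Relative version of \<open>gderiv\<close>. If \<open>S\<close> has empty interior, the gradient relative to \<open>S\<close>
  need not be unique, hence a relation rather than a function.
\<close>

definition has_gradient_on ::
  "('x::real_inner \<Rightarrow> real) \<Rightarrow> ('x \<Rightarrow> 'x) \<Rightarrow> 'x set \<Rightarrow> bool"
where
  "has_gradient_on f g S \<longleftrightarrow> (\<forall>x\<in>S. (f has_derivative (\<lambda>h. inner h (g x))) (at x within S))"

text \<open>The Hessian is measured in the operator norm.\<close>

definition smooth_policy_class ::
  "(real ^ 'd) set \<Rightarrow> (real ^ 'd \<Rightarrow> ('s, 'a) policy) \<Rightarrow> real \<Rightarrow> real \<Rightarrow> bool"
where
  "smooth_policy_class \<Theta> \<pi> k l \<longleftrightarrow>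
     (\<forall>s a. \<exists>(g :: real ^ 'd \<Rightarrow> real ^ 'd) (H :: real ^ 'd \<Rightarrow> real ^ 'd ^ 'd).
        has_gradient_on (\<lambda>\<theta>. pmf (\<pi> \<theta> s) a) g \<Theta> \<and>
        (\<forall>\<theta>\<in>\<Theta>. (g has_derivative (\<lambda>h. H \<theta> *v h)) (at \<theta> within \<Theta>)) \<and>
        (\<forall>\<theta>\<in>\<Theta>. norm (g \<theta>) \<le> k \<and> onorm (\<lambda>h. H \<theta> *v h) \<le> l))"

section \<open>The primal-dual algorithm\<close>

definition lagrangian ::
  "('p \<Rightarrow> real) \<Rightarrow> ('p \<Rightarrow> real) \<Rightarrow> real \<Rightarrow> 'p \<Rightarrow> real \<Rightarrow> real"
where
  "lagrangian Vr Vc b \<theta> lam = Vr \<theta> + lam * (Vc \<theta> - b)"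

definition pd_b :: "real \<Rightarrow> nat \<Rightarrow> real" where
  "pd_b \<xi> t = 19 / (20 * \<xi> * real t powr (1/4))"

definition pd_beta :: "real \<Rightarrow> nat \<Rightarrow> real" where
  "pd_beta \<xi> t = 1 / \<xi>"

definition pd_mu :: "real \<Rightarrow> real \<Rightarrow> real \<Rightarrow> real \<Rightarrow> nat \<Rightarrow> real" where
  "pd_mu C \<nu> \<tau> \<xi> t = \<xi> * C\<^sup>2 + 16 * \<tau> * C\<^sup>2 / (\<xi> * (pd_b \<xi> (t + 1))\<^sup>2) - 2 * \<nu>"

definition pd_alpha :: "real \<Rightarrow> real \<Rightarrow> real \<Rightarrow> real \<Rightarrow> nat \<Rightarrow> real" where
  "pd_alpha C \<nu> \<tau> \<xi> t = \<nu> + pd_mu C \<nu> \<tau> \<xi> t"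

text \<open>
  The stationarity measure at \<open>(\<theta>, lam)\<close> for step parameters \<open>\<alpha>\<close>, \<open>\<beta>\<close>, where \<open>g\<^sub>\<theta>\<close> and
  \<open>g\<^sub>l\<close> are the partial gradients there. The product norm is the Euclidean norm of the
  stacked vector.
\<close>

definition gradient_map ::
  "'p::euclidean_space set \<Rightarrow> real \<Rightarrow> real \<Rightarrow> real \<Rightarrow> 'p \<Rightarrow> real \<Rightarrow> 'p \<Rightarrow> real \<Rightarrow> real \<times> 'p"
where
  "gradient_map \<Theta> \<Lambda> \<alpha> \<beta> g\<^sub>\<theta> g\<^sub>l \<theta> lam =
     (\<beta> * (lam - closest_point {0..\<Lambda>} (lam - 1 / \<beta> * g\<^sub>l)),
      \<alpha> *\<^sub>R (\<theta> - closest_point \<Theta> (\<theta> + (1 / \<alpha>) *\<^sub>R g\<^sub>\<theta>)))"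

end

theory Submission
  imports Defs
begin

text \<open>
  If the dual gradient step stays in \<open>[0, \<Lambda>]\<close>, the projection does nothing and the dual
  component of \<open>G\<^sub>W\<close> is exactly the constraint slack \<open>V\<^sub>c(\<rho>) - b\<close>; it is therefore
  bounded by \<open>\<parallel>G\<^sub>W\<parallel> \<le> 2\<epsilon>\<close>.
\<close>

text \<open>The Lagrangian is affine in the multiplier, so its slope is the constraint slack at
  every real \<open>y\<close>, the endpoints of the dual interval included.\<close>

lemma deriv_lagrangian: "deriv (lagrangian Vr Vc b x) y = Vc x - b"
proof -
  have "(lagrangian Vr Vc b x has_field_derivative Vc x - b) (at y)"
    unfolding lagrangian_def by (auto intro!: derivative_eq_intros)
  then show ?thesis
    by (rule DERIV_imp_deriv)
qed

text \<open>The projection fixes a point that already lies in the interval, so the dual component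
  collapses to \<open>\<beta> * (1 / \<beta> * gy) = gy\<close>; cancelling needs
  \<open>\<beta> \<noteq> 0\<close>. A component of a pair is bounded by the Euclidean norm of the
  pair.\<close>

lemma abs_le_norm_gradient_map:
  assumes "\<beta> \<noteq> 0" and "y - 1 / \<beta> * gy \<in> {0..\<Lambda>}"
  shows "\<bar>gy\<bar> \<le> norm (gradient_map \<Theta> \<Lambda> \<alpha> \<beta> gx gy x y)"
proof -
  have "fst (gradient_map \<Theta> \<Lambda> \<alpha> \<beta> gx gy x y) = gy"
    using assms by (simp add: gradient_map_def closest_point_self)
  then show ?thesis
    by (metis norm_fst_le prod.collapse real_norm_def)
qed

theorem proposition1:
  fixes r c :: "'s::finite \<Rightarrow> 'a::finite \<Rightarrow> real"
    and U :: "'s \<Rightarrow> 'a \<Rightarrow> 's pmf set"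
    and \<rho> :: "'s pmf"
    and \<pi> :: "real ^ 'd \<Rightarrow> ('s, 'a) policy"
    and \<Theta> :: "(real ^ 'd) set"
    and Vr Vc :: "real ^ 'd \<Rightarrow> real"
    and VL DlVL :: "real ^ 'd \<Rightarrow> real \<Rightarrow> real"
    and DVr DVc :: "real ^ 'd \<Rightarrow> real ^ 'd"
    and DVL :: "real ^ 'd \<Rightarrow> real \<Rightarrow> real ^ 'd"
    and \<theta> :: "nat \<Rightarrow> real ^ 'd" and lam :: "nat \<Rightarrow> real"
    and \<alpha> \<beta> :: "nat \<Rightarrow> real"
    and G :: "nat \<Rightarrow> real \<times> (real ^ 'd)"
    and T :: "real \<Rightarrow> nat" and W :: nat
    and \<gamma> b k l \<zeta> \<Lambda> L11 L12 L21 L22 C \<nu> \<tau> \<xi> \<epsilon> :: real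
  defines "Vr \<equiv> \<lambda>x. robust_value_from \<rho> U \<gamma> r (\<pi> x)"
    and "Vc \<equiv> \<lambda>x. robust_value_from \<rho> U \<gamma> c (\<pi> x)"
    and "VL \<equiv> lagrangian Vr Vc b"
    and "DlVL \<equiv> \<lambda>x y. deriv (VL x) y"
    and "\<alpha> \<equiv> pd_alpha C \<nu> \<tau> \<xi>"
    and "\<beta> \<equiv> pd_beta \<xi>"
    and "G \<equiv> \<lambda>t. gradient_map \<Theta> \<Lambda> (\<alpha> t) (\<beta> t)
               (DVL (\<theta> t) (lam t)) (DlVL (\<theta> t) (lam t)) (\<theta> t) (lam t)"
  assumes \<gamma>: "0 \<le> \<gamma>" "\<gamma> < 1"
    and r: "\<And>s a. r s a \<in> {0..1}"
    and c: "\<And>s a. c s a \<in> {0..1}"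
    and b: "b > 0"
    and U: "\<And>s a. U s a \<noteq> {}"
    and \<Theta>: "\<Theta> \<noteq> {}" "closed \<Theta>" "convex \<Theta>"
    and policies: "smooth_policy_class \<Theta> \<pi> k l"
    and slater: "\<zeta> > 0" "\<exists>x\<in>\<Theta>. Vc x - b \<ge> \<zeta>"
    and \<Lambda>: "\<Lambda> \<ge> 2 / (\<zeta> * (1 - \<gamma>))"
    and VL_differentiable: "(\<lambda>(x, y). VL x y) differentiable_on \<Theta> \<times> {0..\<Lambda>}"
    and DVr: "has_gradient_on Vr DVr \<Theta>"
    and DVc: "has_gradient_on Vc DVc \<Theta>"
    and DVL: "\<And>y. y \<in> {0..\<Lambda>} \<Longrightarrow> has_gradient_on (\<lambda>x. VL x y) (\<lambda>x. DVL x y) \<Theta>"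
    and L11: "\<And>y. y \<in> {0..\<Lambda>} \<Longrightarrow> L11-lipschitz_on \<Theta> (\<lambda>x. DlVL x y)"
    and L12: "\<And>x. x \<in> \<Theta> \<Longrightarrow> L12-lipschitz_on {0..\<Lambda>} (DlVL x)"
    and L21: "\<And>y. y \<in> {0..\<Lambda>} \<Longrightarrow> L21-lipschitz_on \<Theta> (\<lambda>x. DVL x y)"
    and L22: "\<And>x. x \<in> \<Theta> \<Longrightarrow> L22-lipschitz_on {0..\<Lambda>} (DVL x)"
    and params: "C \<ge> max L11 L22" "C > 0" "\<nu> > 0" "\<tau> > 2" "\<xi> > (2 * \<nu> + L21) / C\<^sup>2"
    and init: "\<theta> 1 \<in> \<Theta>" "lam 1 \<in> {0..\<Lambda>}"
    and lam_update: "\<And>t. t \<ge> 1 \<Longrightarrow> lam (t + 1) =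
          closest_point {0..\<Lambda>}
            (lam t - 1 / \<beta> t * (Vc (\<theta> t) - b) - pd_b \<xi> t / \<beta> t * lam t)"
    and \<theta>_update: "\<And>t. t \<ge> 1 \<Longrightarrow> \<theta> (t + 1) =
          closest_point \<Theta>
            (\<theta> t + (1 / \<alpha> t) *\<^sub>R (DVr (\<theta> t) + lam (t + 1) *\<^sub>R DVc (\<theta> t)))"
    and \<epsilon>: "\<epsilon> \<in> {0<..<1}"
    and T_order: "(\<lambda>e. real (T e)) \<in> O[at_right 0](\<lambda>e. e powr (-4))"
    and T: "T \<epsilon> \<ge> 1" "(MIN t\<in>{1..T \<epsilon>}. norm (G t)) \<le> 2 * \<epsilon>"
    and W: "is_arg_min (\<lambda>t. norm (G t)) (\<lambda>t. t \<in> {1..T \<epsilon>}) W"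
    and interior: "lam W - 1 / \<beta> W * DlVL (\<theta> W) (lam W) \<in> {0..<\<Lambda>}"
  shows "Vc (\<theta> W) \<ge> b - 2 * \<epsilon>"
proof -
  \<comment> \<open>A Lipschitz constant is nonnegative; \<open>lam 1\<close> serves as the dual
    point at which the Lipschitz hypothesis is instantiated. The purpose is to obtain
    \<open>\<xi> > 0\<close>.\<close>
  have "0 \<le> L21"
    using lipschitz_on_nonneg[OF L21[OF init(2)]] .
  then have "0 < (2 * \<nu> + L21) / C\<^sup>2"
    using params(2,3) by simp
  \<comment> \<open>Since \<open>\<beta> W = 1 / \<xi>\<close>, only \<open>\<xi> = 0\<close> could
    make it vanish, by the convention \<open>1 / 0 = 0\<close>; the lower bound on
    \<open>\<xi>\<close> is positive.\<close>
  then have "\<beta> W \<noteq> 0"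
    using params(5) by (simp add: \<beta>_def pd_beta_def)
  moreover have DlVL: "DlVL (\<theta> W) (lam W) = Vc (\<theta> W) - b"
    by (simp add: DlVL_def VL_def deriv_lagrangian)
  \<comment> \<open>The half-open interval of \<open>interior\<close> lies inside the closed one on
    which the projection is the identity.\<close>
  ultimately have "\<bar>Vc (\<theta> W) - b\<bar> \<le> norm (G W)"
    unfolding G_def DlVL using interior DlVL by (intro abs_le_norm_gradient_map) auto
  \<comment> \<open>\<open>T \<epsilon> \<ge> 1\<close> makes the index set nonempty, so the
    \<open>MIN\<close> is a true minimum and the minimality of \<open>W\<close> bounds it from
    below.\<close>
  also have "\<dots> \<le> (MIN t\<in>{1..T \<epsilon>}. norm (G t))"
    using W T(1) by (auto simp: is_arg_min_linorder)
  also have "\<dots> \<le> 2 * \<epsilon>"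
    by (rule T(2))
  finally show ?thesis
    by linarith
qed

end
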